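(* Let $B/\mathbb F_q$ be a finite étale cubic algebra with $\operatorname{char}\mathbb F_q\ne2,3$, let $\gamma\in B^\times$, let $\omega\in B$ generate $B$ as an $\mathbb F_q$-algebra, and let $C\subset\mathbb F_q^\times$ be nonempty. Let $X_{C,\gamma}=\{h\in B^\times:\operatorname{Norm}(h)\in C,\ \operatorname{Tr}(\gamma h)=0\}$ and $X^{\rm sing}_{C,\gamma}=\{h\in X_{C,\gamma}:\operatorname{Tr}(\omega\gamma h)=0\}$. Let $f_\omega$ be the characteristic polynomial of multiplication by $\omega$ on $B$ and $D_\omega=\operatorname{disc}(f_\omega)$. Then \[ \#X^{\rm sing}_{C,\gamma}=\sum_{\delta\in C}\#\{u\in\mathbb F_q^\times:u^3=-\operatorname{Norm}(\gamma)\delta D_\omega\},\qquad \#X_{C,\gamma}=\sum_{\delta\in C}N_B(\operatorname{Norm}(\gamma)\delta), \] so the transverse count $\#(X_{C,\gamma}\setminus X^{\rm sing}_{C,\gamma})$ is the difference of these. For a single fiber $C=\{\delta\}$ the singular count is $1$ if $q\equiv2\pmod3$; $3$ if $q\equiv1\pmod3$ and $-\operatorname{Norm}(\gamma)\delta D_\omega\in(\mathbb F_q^\times)^3$; and $0$ if $q\equiv1\pmod 3$ and $-\operatorname{Norm}(\gamma)\delta D_\omega\notin(\mathbb F_q^\times)^3$.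
   Context: Traces and norms are $\operatorname{Tr}_{B/\mathbb F_q}$, $\operatorname{Norm}_{B/\mathbb F_q}$. For $\varepsilon\in\mathbb F_q^\times$, $N_B(\varepsilon)=\#\{x\in B^\times:\operatorname{Tr}(x)=0,\ \operatorname{Norm}(x)=\varepsilon\}$. *)

theory Defs
  imports
    "HOL-Library.Cardinality"
    "Jordan_Normal_Form.Char_Poly"
    "Subresultants.Resultant_Prelim"
begin

locale comm_algebra = vector_space scale
  for scale :: "'k::field \<Rightarrow> 'b::comm_ring_1 \<Rightarrow> 'b" +
  assumes scale_mult_left: "scale a (x * y) = scale a x * y"

definition alg_eval :: "('k::field \<Rightarrow> 'b::comm_ring_1 \<Rightarrow> 'b) \<Rightarrow> 'k poly \<Rightarrow> 'b \<Rightarrow> 'b" where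
  "alg_eval scale p x = (\<Sum>i\<le>degree p. scale (coeff p i) (x ^ i))"

text \<open>For an idempotent \<open>e\<close>, the ideal \<open>e B\<close> is a ring with identity \<open>e\<close> and a \<open>k\<close>-algebra
  via \<open>c \<mapsto> scale c e\<close>. The evaluation of \<open>p\<close> at \<open>x \<in> e B\<close> in this algebra is
  \<open>e * alg_eval scale p x\<close>, as the constant term has to be multiplied by \<open>e\<close>.
  In a field extension, the irreducible polynomials annihilating \<open>x\<close> are the unit multiples of
  the minimal polynomial of \<open>x\<close>.\<close>

definition separable_field_factor :: "('k::field \<Rightarrow> 'b::comm_ring_1 \<Rightarrow> 'b) \<Rightarrow> 'b \<Rightarrow> bool" where
  "separable_field_factor scale e \<longleftrightarrow>
     e * e = e \<and> e \<noteq> 0 \<and>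
     (\<forall>x\<in>range ((*) e). x \<noteq> 0 \<longrightarrow> (\<exists>y\<in>range ((*) e). x * y = e)) \<and>
     (\<forall>x\<in>range ((*) e). \<exists>p. irreducible p \<and> e * alg_eval scale p x = 0 \<and> coprime p (pderiv p))"

text \<open>A finite etale algebra over a field is a finite product of finite separable field
  extensions. The product decomposition is expressed internally: \<open>B\<close> is the product of the
  ideals \<open>e B\<close> for a complete finite system \<open>E\<close> of orthogonal idempotents.\<close>

definition finite_etale_algebra :: "('k::field \<Rightarrow> 'b::comm_ring_1 \<Rightarrow> 'b) \<Rightarrow> bool" where
  "finite_etale_algebra scale \<longleftrightarrow>
     comm_algebra scale \<and>
     (\<exists>S. finite S \<and> module.span scale S = UNIV) \<and>
     (\<exists>E. finite E \<and> \<Sum>E = 1 \<and> (\<forall>e\<in>E. \<forall>e'\<in>E. e \<noteq> e' \<longrightarrow> e * e' = 0) \<and>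
          (\<forall>e\<in>E. separable_field_factor scale e))"

definition finite_etale_cubic_algebra :: "('k::field \<Rightarrow> 'b::comm_ring_1 \<Rightarrow> 'b) \<Rightarrow> bool" where
  "finite_etale_cubic_algebra scale \<longleftrightarrow>
     finite_etale_algebra scale \<and> vector_space.dim scale (UNIV :: 'b set) = 3"

definition subalgebra :: "('k::field \<Rightarrow> 'b::comm_ring_1 \<Rightarrow> 'b) \<Rightarrow> 'b set \<Rightarrow> bool" where
  "subalgebra scale A \<longleftrightarrow>
     module.subspace scale A \<and> 1 \<in> A \<and> (\<forall>x\<in>A. \<forall>y\<in>A. x * y \<in> A)"

definition generates_algebra :: "('k::field \<Rightarrow> 'b::comm_ring_1 \<Rightarrow> 'b) \<Rightarrow> 'b \<Rightarrow> bool" where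
  "generates_algebra scale w \<longleftrightarrow> subalgebra scale hull {w} = UNIV"

text \<open>Trace, norm and characteristic polynomial of an element are those of the matrix of
  multiplication by it. The basis is arbitrary, since they do not depend on it.\<close>

definition alg_basis :: "('k::field \<Rightarrow> 'b::comm_ring_1 \<Rightarrow> 'b) \<Rightarrow> 'b list" where
  "alg_basis scale =
     (SOME bs. distinct bs \<and> \<not> module.dependent scale (set bs) \<and> module.span scale (set bs) = UNIV)"

definition mult_matrix :: "('k::field \<Rightarrow> 'b::comm_ring_1 \<Rightarrow> 'b) \<Rightarrow> 'b \<Rightarrow> 'k mat" where
  "mult_matrix scale x =
     (let bs = alg_basis scale; n = length bs
      in mat n n (\<lambda>(i, j). module.representation scale (set bs) (x * bs ! j) (bs ! i)))"

definition alg_trace :: "('k::field \<Rightarrow> 'b::comm_ring_1 \<Rightarrow> 'b) \<Rightarrow> 'b \<Rightarrow> 'k" where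
  "alg_trace scale x = (\<Sum>i<dim_row (mult_matrix scale x). mult_matrix scale x $$ (i, i))"

definition alg_norm :: "('k::field \<Rightarrow> 'b::comm_ring_1 \<Rightarrow> 'b) \<Rightarrow> 'b \<Rightarrow> 'k" where
  "alg_norm scale x = det (mult_matrix scale x)"

definition alg_char_poly :: "('k::field \<Rightarrow> 'b::comm_ring_1 \<Rightarrow> 'b) \<Rightarrow> 'b \<Rightarrow> 'k poly" where
  "alg_char_poly scale x = char_poly (mult_matrix scale x)"

definition poly_disc :: "'k::field poly \<Rightarrow> 'k" where
  "poly_disc f =
     (-1) ^ (degree f * (degree f - 1) div 2) * resultant f (pderiv f) / lead_coeff f"

definition elem_disc :: "('k::field \<Rightarrow> 'b::comm_ring_1 \<Rightarrow> 'b) \<Rightarrow> 'b \<Rightarrow> 'k" where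
  "elem_disc scale w = poly_disc (alg_char_poly scale w)"

definition trace_zero_count :: "('k::field \<Rightarrow> 'b::comm_ring_1 \<Rightarrow> 'b) \<Rightarrow> 'k \<Rightarrow> nat" where
  "trace_zero_count scale \<epsilon> = card {x. x dvd 1 \<and> alg_trace scale x = 0 \<and> alg_norm scale x = \<epsilon>}"

definition X_set :: "('k::field \<Rightarrow> 'b::comm_ring_1 \<Rightarrow> 'b) \<Rightarrow> 'k set \<Rightarrow> 'b \<Rightarrow> 'b set" where
  "X_set scale C \<gamma> = {h. h dvd 1 \<and> alg_norm scale h \<in> C \<and> alg_trace scale (\<gamma> * h) = 0}"

definition X_sing :: "('k::field \<Rightarrow> 'b::comm_ring_1 \<Rightarrow> 'b) \<Rightarrow> 'b \<Rightarrow> 'k set \<Rightarrow> 'b \<Rightarrow> 'b set" where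
  "X_sing scale \<omega> C \<gamma> = {h \<in> X_set scale C \<gamma>. alg_trace scale (\<omega> * \<gamma> * h) = 0}"

end

theory Submission
  imports Defs
begin

text \<open>Let \<open>f\<close> be the characteristic polynomial of \<open>\<omega>\<close>, of degree \<open>n\<close>. By Cayley-Hamilton the powers
  of \<open>\<omega>\<close> below \<open>n\<close> are a basis, and by Euler's formula \<open>Tr h\<close> is the coefficient of \<open>h f'(\<omega>)\<close> at
  \<open>\<omega>\<^sup>n\<^sup>-\<^sup>1\<close>. So \<open>h\<close> is orthogonal to \<open>1, \<dots>, \<omega>\<^sup>n\<^sup>-\<^sup>2\<close> iff \<open>h f'(\<omega>)\<close> is a scalar. As the algebra is
  etale, \<open>f'(\<omega>)\<close> is a unit; its norm is \<open>Res(f, f')\<close>, which is \<open>- D\<close> for \<open>n = 3\<close>. The singular \<open>h\<close>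
  are therefore the elements \<open>u / (\<gamma> f'(\<omega>))\<close> with \<open>u \<noteq> 0\<close> a scalar, and these have norm
  \<open>- u\<^sup>3 / (Norm \<gamma> D)\<close>. The total count is the substitution \<open>x = \<gamma> h\<close>.\<close>

section \<open>Polynomials over a field\<close>

lemma sum_monoms_descending:
  assumes "\<And>i. N \<le> i \<Longrightarrow> coeff p i = 0"
  shows "(\<Sum>k<N. monom (coeff p (N - Suc k)) (N - Suc k)) = p"
proof -
  have "(\<Sum>k<N. monom (coeff p (N - Suc k)) (N - Suc k)) = (\<Sum>k<N. monom (coeff p k) k)"
    by (rule sum.nat_diff_reindex)
  also have "\<dots> = p"
    using assms by (intro poly_eqI) (simp add: coeff_sum not_less)
  finally show ?thesis .
qed

lemma coeff_mod_eq_0: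
  fixes f :: "'a::field poly"
  assumes "f \<noteq> 0" "degree f \<le> j"
  shows "coeff (h mod f) j = 0"
  using degree_mod_less[OF assms(1), of h] assms(2) by (auto intro: coeff_eq_0)

lemma coeff_div_eq_0:
  fixes f :: "'a::field poly"
  assumes "degree h < m + degree f" "m \<le> j"
  shows "coeff (h div f) j = 0"
proof (rule ccontr)
  assume nonzero: "coeff (h div f) j \<noteq> 0"
  then have "h div f \<noteq> 0" "f \<noteq> 0" by auto
  then have "degree (h div f * f) = degree (h div f) + degree f"
    by (rule degree_mult_eq)
  moreover have "m \<le> degree (h div f)"
    using le_degree[OF nonzero] assms(2) by simp
  moreover have "h mod f = 0 \<or> degree (h mod f) < degree f"
    by (rule degree_mod_less[OF \<open>f \<noteq> 0\<close>])
  ultimately have "degree (h div f * f + h mod f) \<ge> m + degree f"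
    using degree_add_eq_left[of "h mod f" "h div f * f"] by auto
  with assms(1) show False by simp
qed

lemma sum_div_mod_monoms_descending:
  fixes f h :: "'a::field poly"
  assumes "f \<noteq> 0" and degree: "degree h < m + degree f"
  shows "(\<Sum>k<m. Polynomial.smult (coeff (h div f) (m - Suc k)) (monom 1 (m - Suc k) * f)) +
    (\<Sum>k<degree f. Polynomial.smult (coeff (h mod f) (degree f - Suc k))
      (monom 1 (degree f - Suc k))) = h"
proof -
  have "(\<Sum>k<m. Polynomial.smult (coeff (h div f) (m - Suc k)) (monom 1 (m - Suc k) * f)) =
      (\<Sum>k<m. monom (coeff (h div f) (m - Suc k)) (m - Suc k)) * f"
    by (simp add: sum_distrib_right smult_monom flip: mult_smult_left)
  also have "\<dots> = h div f * f"
    using coeff_div_eq_0[OF degree] by (simp add: sum_monoms_descending)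
  finally show ?thesis
    using coeff_mod_eq_0[OF \<open>f \<noteq> 0\<close>] by (simp add: smult_monom sum_monoms_descending)
qed

lemma poly_shift_Suc: "poly_shift n p = pCons (coeff p n) (poly_shift (Suc n) p)"
  by (intro poly_eqI) (auto simp: coeff_poly_shift coeff_pCons split: nat.splits)

lemma pderiv_eq_sum_poly_shift:
  "pderiv p = (\<Sum>i<degree p. monom 1 i * poly_shift (Suc i) p)"
proof (rule poly_eqI)
  fix k
  have "coeff (\<Sum>i<degree p. monom 1 i * poly_shift (Suc i) p) k =
      (\<Sum>i<degree p. if i \<le> k then coeff p (Suc k) else 0)"
    by (auto simp: coeff_sum coeff_monom_mult coeff_poly_shift intro!: sum.cong)
  also have "\<dots> = of_nat (card {i. i < degree p \<and> i \<le> k}) * coeff p (Suc k)"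
    by (simp add: sum.If_cases Int_def)
  also have "\<dots> = coeff (pderiv p) k"
  proof (cases "k < degree p")
    case True
    then have "{i. i < degree p \<and> i \<le> k} = {..k}" by auto
    then show ?thesis by (simp add: coeff_pderiv)
  qed (simp add: coeff_pderiv coeff_eq_0)
  finally show "coeff (pderiv p) k = coeff (\<Sum>i<degree p. monom 1 i * poly_shift (Suc i) p) k"
    by (rule sym)
qed

lemma poly_ideal_principal:
  fixes I :: "'a::field poly set"
  assumes add: "\<And>p q. p \<in> I \<Longrightarrow> q \<in> I \<Longrightarrow> p + q \<in> I"
    and mult: "\<And>p q. p \<in> I \<Longrightarrow> q * p \<in> I"
    and "I \<noteq> {}"
  obtains m where "m \<in> I" "\<And>p. p \<in> I \<Longrightarrow> m dvd p"
proof (cases "I \<subseteq> {0}")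
  case True
  moreover have "0 \<in> I"
    using mult[of _ 0] \<open>I \<noteq> {}\<close> by auto
  ultimately show ?thesis by (intro that[of 0]) auto
next
  case False
  then obtain m where m: "m \<in> I" "m \<noteq> 0"
    and least: "\<And>p. p \<in> I \<Longrightarrow> p \<noteq> 0 \<Longrightarrow> degree m \<le> degree p"
    using ex_has_least_nat[of "\<lambda>p. p \<in> I \<and> p \<noteq> 0" _ degree] by blast
  have "m dvd p" if "p \<in> I" for p
  proof -
    have "p + - (p div m) * m \<in> I"
      by (intro add mult that m)
    then have "p mod m \<in> I"
      by (simp flip: minus_div_mult_eq_mod)
    then show ?thesis
      using least[of "p mod m"] degree_mod_less'[OF m(2), of p] by (metis mod_eq_0_iff_dvd not_le)
  qed
  with m(1) show ?thesis by (rule that)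
qed

lemma irreducible_dvd_ideal:
  fixes I :: "'a::field poly set"
  assumes add: "\<And>p q. p \<in> I \<Longrightarrow> q \<in> I \<Longrightarrow> p + q \<in> I"
    and mult: "\<And>p q. p \<in> I \<Longrightarrow> q * p \<in> I"
    and "1 \<notin> I" "irreducible p" "p \<in> I" "q \<in> I"
  shows "p dvd q"
proof -
  obtain m where m: "m \<in> I" "\<And>p. p \<in> I \<Longrightarrow> m dvd p"
    using poly_ideal_principal[OF add mult] \<open>p \<in> I\<close> by blast
  have "\<not> m dvd 1"
    using mult[OF m(1)] \<open>1 \<notin> I\<close> by (metis dvdE mult.commute)
  then have "p dvd m"
    using irreducibleD'[OF \<open>irreducible p\<close> m(2)[OF \<open>p \<in> I\<close>]] by blast
  then show ?thesis
    using m(2)[OF \<open>q \<in> I\<close>] by (rule dvd_trans)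
qed

lemma square_dvd_if_dvd_pderiv:
  fixes p :: "'a::field poly"
  assumes p: "irreducible p" "coprime p (pderiv p)" and "p dvd f" "p dvd pderiv f"
  shows "p * p dvd f"
proof -
  obtain g where f: "f = p * g"
    using \<open>p dvd f\<close> by (elim dvdE)
  have "p dvd p * pderiv g + g * pderiv p"
    using \<open>p dvd pderiv f\<close> by (simp add: f pderiv_mult)
  then have "p dvd g * pderiv p"
    by (simp add: dvd_add_right_iff)
  moreover have "prime_elem p" "\<not> p dvd pderiv p"
    using p coprime_common_divisor[of p "pderiv p" p]
    by (auto simp: irreducible_def intro: field_poly_irreducible_imp_prime)
  ultimately show ?thesis
    by (auto simp: f prime_elem_dvd_mult_iff intro: mult_dvd_mono)
qed

section \<open>Determinants, traces and resultants\<close>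

lemma det_mult_vec_index_eq_0:
  fixes A :: "'a::comm_ring_1 mat"
  assumes carrier_A: "A \<in> carrier_mat n n" and carrier_v: "v \<in> carrier_vec n"
    and kernel: "A *\<^sub>v v = 0\<^sub>v n" and "i < n"
  shows "det A * v $ i = 0"
proof -
  have "det A \<cdot>\<^sub>v v = (adj_mat A * A) *\<^sub>v v"
    unfolding adj_mat(3)[OF carrier_A] using carrier_v by (auto simp: row_smult)
  also have "\<dots> = adj_mat A *\<^sub>v 0\<^sub>v n"
    using adj_mat(1)[OF carrier_A] carrier_A carrier_v by (simp add: kernel)
  finally have "(det A \<cdot>\<^sub>v v) $ i = (adj_mat A *\<^sub>v 0\<^sub>v n) $ i"
    by simp
  then show ?thesis
    using carrier_v adj_mat(1)[OF carrier_A] \<open>i < n\<close> by simp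
qed

definition mat_trace :: "'a::comm_monoid_add mat \<Rightarrow> 'a" where
  "mat_trace A = (\<Sum>i<dim_row A. A $$ (i, i))"

lemma mat_trace_mult_comm:
  fixes A :: "'a::comm_semiring_0 mat"
  assumes "A \<in> carrier_mat n m" "B \<in> carrier_mat m n"
  shows "mat_trace (A * B) = mat_trace (B * A)"
proof -
  have "mat_trace (A * B) = (\<Sum>i<n. \<Sum>j<m. A $$ (i, j) * B $$ (j, i))"
    using assms
    by (auto simp: mat_trace_def scalar_prod_def lessThan_atLeast0 intro!: sum.cong)
  also have "\<dots> = (\<Sum>j<m. \<Sum>i<n. B $$ (j, i) * A $$ (i, j))"
    by (subst sum.swap) (simp add: mult.commute)
  also have "\<dots> = mat_trace (B * A)"
    using assms
    by (auto simp: mat_trace_def scalar_prod_def lessThan_atLeast0 intro!: sum.cong)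
  finally show ?thesis .
qed

lemma mat_trace_similar:
  fixes A :: "'a::comm_ring_1 mat"
  assumes "similar_mat A B"
  shows "mat_trace A = mat_trace B"
proof -
  from similar_matD[OF assms] obtain n P Q where
    carrier: "A \<in> carrier_mat n n" "B \<in> carrier_mat n n" "P \<in> carrier_mat n n" "Q \<in> carrier_mat n n"
    and QP: "Q * P = 1\<^sub>m n" and A: "A = P * B * Q"
    by auto
  have "mat_trace A = mat_trace (Q * (P * B))"
    unfolding A by (rule mat_trace_mult_comm) (use carrier in auto)
  also have "Q * (P * B) = B"
    using carrier QP by (simp flip: assoc_mult_mat)
  finally show ?thesis .
qed

text \<open>Rows list coefficients from the top degree downwards, as in Sylvester matrices.\<close>

definition coeff_mat :: "nat \<Rightarrow> nat \<Rightarrow> (nat \<Rightarrow> 'a::zero poly) \<Rightarrow> 'a mat" where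
  "coeff_mat r N p = mat r N (\<lambda>(i, j). coeff (p i) (N - Suc j))"

lemma coeff_mat_carrier [simp]:
  "coeff_mat r N p \<in> carrier_mat r N"
  "dim_row (coeff_mat r N p) = r" "dim_col (coeff_mat r N p) = N"
  by (simp_all add: coeff_mat_def)

lemma coeff_mat_cong: "(\<And>i. i < r \<Longrightarrow> p i = q i) \<Longrightarrow> coeff_mat r N p = coeff_mat r N q"
  by (auto simp: coeff_mat_def)

lemma mult_coeff_mat:
  fixes A :: "'a::comm_semiring_0 mat"
  assumes "A \<in> carrier_mat r s"
  shows "A * coeff_mat s N p = coeff_mat r N (\<lambda>i. \<Sum>k<s. Polynomial.smult (A $$ (i, k)) (p k))"
  using assms
  by (intro eq_matI)
    (auto simp: coeff_mat_def scalar_prod_def coeff_sum lessThan_atLeast0 intro!: sum.cong)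

lemma det_coeff_mat_monic:
  fixes p :: "nat \<Rightarrow> 'a::comm_ring_1 poly"
  assumes "\<And>i. i < N \<Longrightarrow> degree (p i) = N - Suc i" "\<And>i. i < N \<Longrightarrow> monic (p i)"
  shows "det (coeff_mat N N p) = 1"
proof -
  have "upper_triangular (coeff_mat N N p)"
    using assms by (auto simp: upper_triangular_def coeff_mat_def intro!: coeff_eq_0)
  then have "det (coeff_mat N N p) = prod_list (diag_mat (coeff_mat N N p))"
    using det_upper_triangular coeff_mat_carrier by blast
  also have "diag_mat (coeff_mat N N p) = map (\<lambda>_. 1) [0..<N]"
    using assms by (simp add: diag_mat_def coeff_mat_def cong: map_cong)
  also have "prod_list (map (\<lambda>_. 1) [0..<N]) = (1 :: 'a)"
    by (induction N) auto
  finally show ?thesis .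
qed

lemma sylvester_mat_eq_coeff_mat:
  fixes f g :: "'a::comm_semiring_1 poly"
  shows "sylvester_mat f g = coeff_mat (degree f + degree g) (degree f + degree g)
    (\<lambda>i. if i < degree g then monom 1 (degree g - Suc i) * f
         else monom 1 (degree f + degree g - Suc i) * g)"
  by (intro eq_matI)
    (auto simp: sylvester_index_mat coeff_mat_def coeff_monom_mult coeff_eq_0
      intro!: arg_cong[where f = "coeff _"])

lemma sum_lessThan_add:
  fixes F :: "nat \<Rightarrow> 'a::comm_monoid_add"
  shows "(\<Sum>k<m + n. F k) = (\<Sum>k<m. F k) + (\<Sum>k<n. F (m + k))"
  by (induction n) (simp_all add: add.assoc)

lemma four_block_mat_mult_coeff_mat:
  fixes Q :: "'a::comm_semiring_1 mat"
  assumes "Q \<in> carrier_mat n m" "R \<in> carrier_mat n n"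
  shows "four_block_mat (1\<^sub>m m) (0\<^sub>m m n) Q R *
      coeff_mat (n + m) N (\<lambda>i. if i < m then p i else q (i - m)) =
    coeff_mat (n + m) N (\<lambda>i. if i < m then p i
      else (\<Sum>k<m. Polynomial.smult (Q $$ (i - m, k)) (p k)) +
        (\<Sum>k<n. Polynomial.smult (R $$ (i - m, k)) (q k)))"
    (is "?L * coeff_mat _ _ ?pq = _")
proof -
  have "?L \<in> carrier_mat (n + m) (n + m)"
    using four_block_carrier_mat[of "1\<^sub>m m" m m R n n] assms(2) by (simp add: add.commute)
  then have "?L * coeff_mat (n + m) N ?pq =
      coeff_mat (n + m) N (\<lambda>i. \<Sum>k<n + m. Polynomial.smult (?L $$ (i, k)) (?pq k))"
    by (rule mult_coeff_mat)
  also have "\<dots> = coeff_mat (n + m) N (\<lambda>i. if i < m then p i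
      else (\<Sum>k<m. Polynomial.smult (Q $$ (i - m, k)) (p k)) +
        (\<Sum>k<n. Polynomial.smult (R $$ (i - m, k)) (q k)))"
  proof (rule coeff_mat_cong)
    fix i assume "i < n + m"
    moreover have "(\<Sum>k<n + m. Polynomial.smult (?L $$ (i, k)) (?pq k)) =
        (\<Sum>k<m. Polynomial.smult (?L $$ (i, k)) (p k)) +
        (\<Sum>k<n. Polynomial.smult (?L $$ (i, m + k)) (q k))"
      by (simp add: add.commute[of n m] sum_lessThan_add)
    ultimately show "(\<Sum>k<n + m. Polynomial.smult (?L $$ (i, k)) (?pq k)) =
        (if i < m then p i
         else (\<Sum>k<m. Polynomial.smult (Q $$ (i - m, k)) (p k)) +
           (\<Sum>k<n. Polynomial.smult (R $$ (i - m, k)) (q k)))"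
      using assms
      by (auto simp: if_distrib[of "\<lambda>c. Polynomial.smult c _"] sum.delta cong: if_cong)
  qed
  finally show ?thesis .
qed

text \<open>Rows \<open>x\<^sup>k g\<close> of the Sylvester matrix are \<open>(x\<^sup>k g div f) f + x\<^sup>k g mod f\<close>, which factors the
  matrix through the monic basis \<open>x\<^sup>m\<^sup>-\<^sup>1 f, \<dots>, f, x\<^sup>n\<^sup>-\<^sup>1, \<dots>, 1\<close> of the polynomials of degree
  below \<open>n + m\<close>.\<close>

lemma sylvester_mat_monic_factorization:
  fixes f g :: "'a::field poly"
  assumes f: "monic f"
  defines "n \<equiv> degree f" and "m \<equiv> degree g"
  defines "x_g \<equiv> \<lambda>i. monom 1 (n - Suc i) * g"
  shows "sylvester_mat f g =
    four_block_mat (1\<^sub>m m) (0\<^sub>m m n)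
      (mat n m (\<lambda>(i, k). coeff (x_g i div f) (m - Suc k))) (coeff_mat n n (\<lambda>i. x_g i mod f)) *
    coeff_mat (n + m) (n + m)
      (\<lambda>i. if i < m then monom 1 (m - Suc i) * f else monom 1 (n - Suc (i - m)))"
    (is "_ = four_block_mat _ _ ?Q ?R * ?U")
proof -
  have "f \<noteq> 0" using f by auto
  have row: "x_g j =
      (\<Sum>k<m. Polynomial.smult (coeff (x_g j div f) (m - Suc k)) (monom 1 (m - Suc k) * f)) +
      (\<Sum>k<n. Polynomial.smult (coeff (x_g j mod f) (n - Suc k)) (monom 1 (n - Suc k)))"
    if "j < n" for j
  proof -
    have "degree (x_g j) \<le> (n - Suc j) + m"
      unfolding x_g_def m_def
      by (rule order.trans[OF degree_mult_le]) (simp add: degree_monom_eq)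
    then have "degree (x_g j) < m + degree f"
      using that by (simp flip: n_def)
    from sum_div_mod_monoms_descending[OF \<open>f \<noteq> 0\<close> this] show ?thesis
      by (simp add: n_def)
  qed
  have "four_block_mat (1\<^sub>m m) (0\<^sub>m m n) ?Q ?R * ?U =
      coeff_mat (n + m) (n + m) (\<lambda>i. if i < m then monom 1 (m - Suc i) * f
        else (\<Sum>k<m. Polynomial.smult (?Q $$ (i - m, k)) (monom 1 (m - Suc k) * f)) +
          (\<Sum>k<n. Polynomial.smult (?R $$ (i - m, k)) (monom 1 (n - Suc k))))"
    by (rule four_block_mat_mult_coeff_mat[where q = "\<lambda>j. monom 1 (n - Suc j)"]) simp_all
  also have "\<dots> = sylvester_mat f g"
    unfolding sylvester_mat_eq_coeff_mat n_def[symmetric] m_def[symmetric]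
  proof (rule coeff_mat_cong)
    fix i assume "i < n + m"
    moreover have "n - Suc (i - m) = n + m - Suc i" if "\<not> i < m"
      using that by simp
    ultimately show "(if i < m then monom 1 (m - Suc i) * f
        else (\<Sum>k<m. Polynomial.smult (?Q $$ (i - m, k)) (monom 1 (m - Suc k) * f)) +
          (\<Sum>k<n. Polynomial.smult (?R $$ (i - m, k)) (monom 1 (n - Suc k)))) =
      (if i < m then monom 1 (m - Suc i) * f else monom 1 (n + m - Suc i) * g)"
      using row[of "i - m"] by (auto simp: coeff_mat_def x_g_def)
  qed
  finally show ?thesis by (rule sym)
qed

lemma resultant_monic_eq_det_residues:
  fixes f g :: "'a::field poly"
  assumes f: "monic f"
  shows "resultant f g = det (coeff_mat (degree f) (degree f)
    (\<lambda>i. monom 1 (degree f - Suc i) * g mod f))"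
proof -
  let ?n = "degree f" and ?m = "degree g"
  let ?R = "coeff_mat ?n ?n (\<lambda>i. monom 1 (?n - Suc i) * g mod f)"
  let ?basis = "\<lambda>i. if i < ?m then monom 1 (?m - Suc i) * f else monom 1 (?n - Suc (i - ?m))"
  let ?U = "coeff_mat (?n + ?m) (?n + ?m) ?basis"
  have "det ?U = 1"
  proof (rule det_coeff_mat_monic)
    fix i
    have "f \<noteq> 0" using f by auto
    then show "degree (?basis i) = ?n + ?m - Suc i" if "i < ?n + ?m"
      using that by (auto simp: degree_mult_eq degree_monom_eq)
    show "monic (?basis i)"
      using f by (auto simp: lead_coeff_mult degree_monom_eq simp del: coeff_monom_mult)
  qed
  let ?Q = "mat ?n ?m (\<lambda>(i, k). coeff (monom 1 (?n - Suc i) * g div f) (?m - Suc k))"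
  let ?L = "four_block_mat (1\<^sub>m ?m) (0\<^sub>m ?m ?n) ?Q ?R"
  have "?L \<in> carrier_mat (?n + ?m) (?n + ?m)"
    using four_block_carrier_mat[of "1\<^sub>m ?m" ?m ?m ?R ?n ?n] by (simp add: add.commute)
  then have "resultant f g = det ?L * det ?U"
    unfolding resultant_def sylvester_mat_monic_factorization[OF f] by (rule det_mult) simp
  also have "det ?L = det (1\<^sub>m ?m) * det ?R"
    by (rule det_four_block_mat_upper_right_zero) auto
  finally show ?thesis
    using \<open>det ?U = 1\<close> by simp
qed

section \<open>Matrices of linear maps\<close>

definition basis_list :: "('a::field \<Rightarrow> 'b::ab_group_add \<Rightarrow> 'b) \<Rightarrow> 'b list \<Rightarrow> bool" where
  "basis_list scale bs \<longleftrightarrow>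
     distinct bs \<and> \<not> module.dependent scale (set bs) \<and> module.span scale (set bs) = UNIV"

definition lin_matrix ::
    "('a::field \<Rightarrow> 'b::ab_group_add \<Rightarrow> 'b) \<Rightarrow> 'b list \<Rightarrow> 'b list \<Rightarrow> ('b \<Rightarrow> 'b) \<Rightarrow> 'a mat" where
  "lin_matrix scale bs cs f =
     mat (length bs) (length cs)
       (\<lambda>(i, j). module.representation scale (set bs) (f (cs ! j)) (bs ! i))"

lemma lin_matrix_carrier [simp]: "lin_matrix scale bs cs f \<in> carrier_mat (length bs) (length cs)"
  by (simp add: lin_matrix_def)

context vector_space
begin

lemma basis_list_length: "basis_list scale bs \<Longrightarrow> length bs = dim UNIV"
  using basis_card_eq_dim[of "set bs" UNIV] by (simp add: basis_list_def distinct_card)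

lemma sum_nth_basis_list: "basis_list scale bs \<Longrightarrow> (\<Sum>i<length bs. h (bs ! i)) = (\<Sum>b\<in>set bs. h b)"
  by (intro sum.reindex_bij_betw bij_betw_nth) (auto simp: basis_list_def)

lemma lin_matrix_id: "basis_list scale bs \<Longrightarrow> lin_matrix scale bs bs (\<lambda>x. x) = 1\<^sub>m (length bs)"
  by (intro eq_matI)
    (auto simp: lin_matrix_def basis_list_def representation_basis nth_eq_iff_index_eq)

lemma lin_matrix_mult:
  assumes as: "basis_list scale as" and bs: "basis_list scale bs"
    and f: "Vector_Spaces.linear scale scale f"
  shows "lin_matrix scale as bs f * lin_matrix scale bs cs g = lin_matrix scale as cs (\<lambda>x. f (g x))"
proof (intro eq_matI)
  interpret f: Vector_Spaces.linear scale scale f by (rule f)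
  fix i j assume "i < dim_row (lin_matrix scale as cs (\<lambda>x. f (g x)))"
    "j < dim_col (lin_matrix scale as cs (\<lambda>x. f (g x)))"
  then have i: "i < length as" and j: "j < length cs" by (auto simp: lin_matrix_def)
  have ind: "independent (set as)" "independent (set bs)"
    and span: "span (set as) = UNIV" "span (set bs) = UNIV"
    using as bs by (auto simp: basis_list_def)
  let ?r = "representation (set bs) (g (cs ! j))"
  have "(lin_matrix scale as bs f * lin_matrix scale bs cs g) $$ (i, j) =
      (\<Sum>k<length bs. representation (set as) (f (bs ! k)) (as ! i) * ?r (bs ! k))"
    using i j by (auto simp: lin_matrix_def scalar_prod_def lessThan_atLeast0 intro!: sum.cong)
  also have "\<dots> = (\<Sum>b\<in>set bs. representation (set as) (f b) (as ! i) * ?r b)"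
    by (rule sum_nth_basis_list[OF bs])
  also have "\<dots> = representation (set as) (\<Sum>b\<in>set bs. scale (?r b) (f b)) (as ! i)"
    using ind span by (simp add: representation_sum representation_scale mult.commute)
  also have "(\<Sum>b\<in>set bs. scale (?r b) (f b)) = f (\<Sum>b\<in>set bs. scale (?r b) b)"
    by (simp add: f.sum f.scale)
  also have "(\<Sum>b\<in>set bs. scale (?r b) b) = g (cs ! j)"
    using ind span by (intro sum_representation_eq) auto
  finally show "(lin_matrix scale as bs f * lin_matrix scale bs cs g) $$ (i, j) =
      lin_matrix scale as cs (\<lambda>x. f (g x)) $$ (i, j)"
    using i j by (simp add: lin_matrix_def)
qed (simp_all add: lin_matrix_def)

lemma lin_matrix_scale:
  "basis_list scale bs \<Longrightarrow>
    lin_matrix scale bs cs (\<lambda>x. scale c (f x)) = c \<cdot>\<^sub>m lin_matrix scale bs cs f"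
  by (intro eq_matI) (auto simp: lin_matrix_def basis_list_def representation_scale)

lemma similar_lin_matrix:
  assumes as: "basis_list scale as" and bs: "basis_list scale bs"
    and f: "Vector_Spaces.linear scale scale f"
  shows "similar_mat (lin_matrix scale as as f) (lin_matrix scale bs bs f)"
proof -
  have id: "Vector_Spaces.linear scale scale (\<lambda>x. x)"
    by (rule linear_ident)
  have length: "length as = length bs"
    using as bs by (simp add: basis_list_length)
  let ?P = "lin_matrix scale as bs (\<lambda>x. x)" and ?Q = "lin_matrix scale bs as (\<lambda>x. x)"
  have "similar_mat_wit (lin_matrix scale as as f) (lin_matrix scale bs bs f) ?P ?Q"
  proof (rule similar_mat_witI)
    show "?P * ?Q = 1\<^sub>m (length bs)" "?Q * ?P = 1\<^sub>m (length bs)"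
      using as bs id length by (simp_all add: lin_matrix_mult lin_matrix_id)
    show "lin_matrix scale as as f = ?P * lin_matrix scale bs bs f * ?Q"
      using as bs id f by (simp add: lin_matrix_mult)
  qed (use length in \<open>simp_all add: lin_matrix_def\<close>)
  then show ?thesis unfolding similar_mat_def by blast
qed

lemma mat_trace_lin_matrix:
  "basis_list scale bs \<Longrightarrow>
    mat_trace (lin_matrix scale bs bs f) = (\<Sum>b\<in>set bs. representation (set bs) (f b) b)"
  using sum_nth_basis_list[of bs "\<lambda>b. representation (set bs) (f b) b"]
  by (simp add: mat_trace_def lin_matrix_def)

lemma finite_span:
  assumes "finite (UNIV :: 'a set)" "finite S"
  shows "finite (span S)"
  using \<open>finite S\<close>
proof induction
  case (insert v S)
  have "span (insert v S) \<subseteq> (\<lambda>(c, u). scale c v + u) ` (UNIV \<times> span S)"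
  proof
    fix u assume "u \<in> span (insert v S)"
    then obtain c where "u - scale c v \<in> span S"
      by (auto simp: span_insert)
    then show "u \<in> (\<lambda>(c, u). scale c v + u) ` (UNIV \<times> span S)"
      by (intro image_eqI[of _ _ "(c, u - scale c v)"]) auto
  qed
  then show ?case
    by (rule finite_subset) (use assms(1) insert.IH in auto)
qed simp

end

section \<open>Finite-dimensional commutative algebras\<close>

context comm_algebra
begin

lemma scale_mult_right: "scale a (x * y) = x * scale a y"
  using scale_mult_left[of a y x] by (simp add: mult.commute)

lemma linear_mult: "Vector_Spaces.linear scale scale ((*) x)"
  by unfold_locales (simp_all add: distrib_left scale_mult_right)

lemma mult_matrix_eq_lin_matrix:
  "mult_matrix scale x = lin_matrix scale (alg_basis scale) (alg_basis scale) ((*) x)"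
  by (simp add: mult_matrix_def lin_matrix_def Let_def)

sublocale scalar: comm_ring_hom "\<lambda>c. scale c 1"
  by unfold_locales (simp_all add: scale_left_distrib flip: scale_mult_left)

lemma alg_eval_eq_eval_poly: "alg_eval scale p x = eval_poly (\<lambda>c. scale c 1) p x"
  by (simp add: alg_eval_def eval_poly_as_sum flip: scale_mult_right)

sublocale alg_eval: comm_ring_hom "\<lambda>p. alg_eval scale p x"
proof -
  interpret map_poly_comm_ring_hom "\<lambda>c. scale c 1" ..
  show "comm_ring_hom (\<lambda>p. alg_eval scale p x)"
    by unfold_locales (simp_all add: alg_eval_eq_eval_poly eval_poly_def hom_distribs)
qed

lemma alg_eval_pCons: "alg_eval scale (pCons c p) x = scale c 1 + x * alg_eval scale p x"
  unfolding alg_eval_eq_eval_poly eval_poly_def by (subst Polynomial.map_poly_pCons) simp_all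

lemma alg_eval_monom: "alg_eval scale (monom c i) x = scale c (x ^ i)"
  by (simp add: alg_eval_eq_eval_poly scalar.eval_poly_monom flip: scale_mult_left)

lemma alg_eval_smult: "alg_eval scale (Polynomial.smult c p) x = scale c (alg_eval scale p x)"
  using alg_eval.hom_mult[of "[:c:]" p x]
  by (simp add: alg_eval_pCons flip: scale_mult_left)

lemma alg_eval_as_sum:
  assumes "\<And>i. n \<le> i \<Longrightarrow> coeff p i = 0"
  shows "alg_eval scale p x = (\<Sum>i<n. scale (coeff p i) (x ^ i))"
proof -
  have "p = (\<Sum>i<n. monom (coeff p i) i)"
    using assms by (intro poly_eqI) (simp add: coeff_sum not_less)
  then have "alg_eval scale p x = alg_eval scale (\<Sum>i<n. monom (coeff p i) i) x"
    by (rule arg_cong)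
  then show ?thesis
    by (simp add: alg_eval.hom_sum alg_eval_monom)
qed

lemma alg_eval_mult_idempotent:
  assumes "e * e = e"
  shows "e * alg_eval scale p (e * x) = e * alg_eval scale p x"
proof (induction p)
  case (pCons c p)
  have "e * alg_eval scale (pCons c p) (e * x) =
      e * scale c 1 + x * (e * e * alg_eval scale p (e * x))"
    by (simp add: alg_eval_pCons algebra_simps)
  also have "\<dots> = e * scale c 1 + x * (e * alg_eval scale p x)"
    using assms pCons.IH by simp
  finally show ?case
    by (simp add: alg_eval_pCons algebra_simps)
qed (simp add: alg_eval.hom_zero)

lemma subalgebra_range_alg_eval: "subalgebra scale (range (\<lambda>p. alg_eval scale p x))"
  using rangeI[of "\<lambda>p. alg_eval scale p x" 0] rangeI[of "\<lambda>p. alg_eval scale p x" 1]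
  unfolding subalgebra_def subspace_def
  by (auto simp flip: alg_eval.hom_add alg_eval.hom_mult alg_eval_smult)

lemma generates_algebra_imp_alg_eval_surj:
  assumes "generates_algebra scale w"
  shows "surj (\<lambda>p. alg_eval scale p w)"
proof -
  have "w = alg_eval scale [:0, 1:] w"
    by (simp add: alg_eval_pCons)
  then have "subalgebra scale hull {w} \<subseteq> range (\<lambda>p. alg_eval scale p w)"
    by (intro hull_minimal subalgebra_range_alg_eval) auto
  then show ?thesis
    using assms by (auto simp: generates_algebra_def)
qed

end

locale finite_dim_comm_algebra = comm_algebra +
  assumes finite_spanning_set: "\<exists>S. finite S \<and> span S = UNIV"
begin

lemma basis_list_alg_basis: "basis_list scale (alg_basis scale)"
proof -
  obtain S B where "finite S" "span S = UNIV" "B \<subseteq> S" "independent B" "S \<subseteq> span B"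
    using finite_spanning_set maximal_independent_subset by metis
  then have "finite B" "span B = UNIV"
    by (auto intro: finite_subset) (metis UNIV_I span_mono span_span subsetD)
  then obtain bs where "basis_list scale bs"
    using finite_distinct_list[of B] \<open>independent B\<close> by (auto simp: basis_list_def)
  then show ?thesis
    unfolding basis_list_def alg_basis_def by (rule someI)
qed

abbreviation rank :: nat where "rank \<equiv> dim UNIV"

lemma mult_matrix_carrier: "mult_matrix scale x \<in> carrier_mat rank rank"
  unfolding mult_matrix_eq_lin_matrix basis_list_length[OF basis_list_alg_basis, symmetric] by simp

lemma basis_list_if_spanning:
  assumes "span (set bs) = UNIV" "length bs \<le> rank"
  shows "basis_list scale bs"
proof -
  interpret finite_dimensional_vector_space scale "set (alg_basis scale)"
    using basis_list_alg_basis by unfold_locales (auto simp: basis_list_def)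
  have "rank \<le> card (set bs)"
    using dim_le_card[of UNIV "set bs"] assms(1) by simp
  then have "card (set bs) = length bs" "card (set bs) = rank"
    using card_length[of bs] assms(2) by auto
  then show ?thesis
    using card_le_dim_spanning[of "set bs" UNIV] assms(1) card_distinct[of bs]
    by (simp add: basis_list_def)
qed

lemma similar_mult_matrix:
  "basis_list scale bs \<Longrightarrow> similar_mat (mult_matrix scale x) (lin_matrix scale bs bs ((*) x))"
  unfolding mult_matrix_eq_lin_matrix
  by (intro similar_lin_matrix basis_list_alg_basis linear_mult)

lemma alg_norm_eq_det_lin_matrix:
  "basis_list scale bs \<Longrightarrow> alg_norm scale x = det (lin_matrix scale bs bs ((*) x))"
  unfolding alg_norm_def by (intro det_similar similar_mult_matrix)

lemma alg_trace_eq_sum_representation: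
  assumes "basis_list scale bs"
  shows "alg_trace scale x = (\<Sum>b\<in>set bs. representation (set bs) (x * b) b)"
  using mat_trace_similar[OF similar_mult_matrix[OF assms, of x]] assms
  by (simp add: alg_trace_def mat_trace_lin_matrix flip: mat_trace_def)

lemma alg_norm_mult: "alg_norm scale (x * y) = alg_norm scale x * alg_norm scale y"
proof -
  have "mult_matrix scale (x * y) = mult_matrix scale x * mult_matrix scale y"
    unfolding mult_matrix_eq_lin_matrix
    using lin_matrix_mult[OF basis_list_alg_basis basis_list_alg_basis linear_mult, of x _ "(*) y"]
    by (simp add: mult.assoc[symmetric, abs_def])
  then show ?thesis
    by (simp add: alg_norm_def det_mult[OF mult_matrix_carrier mult_matrix_carrier])
qed

lemma alg_norm_scale: "alg_norm scale (scale c x) = c ^ rank * alg_norm scale x"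
proof -
  have "mult_matrix scale (scale c x) = c \<cdot>\<^sub>m mult_matrix scale x"
    unfolding mult_matrix_eq_lin_matrix lin_matrix_scale[OF basis_list_alg_basis, symmetric]
    by (simp add: scale_mult_left)
  then show ?thesis
    using mult_matrix_carrier[of x] by (simp add: alg_norm_def)
qed

lemma alg_norm_1: "alg_norm scale 1 = 1"
  using lin_matrix_id[OF basis_list_alg_basis]
  by (simp add: alg_norm_eq_det_lin_matrix[OF basis_list_alg_basis] mult_1_left[abs_def])

lemma alg_norm_unit_nonzero: "x dvd 1 \<Longrightarrow> alg_norm scale x \<noteq> 0"
  by (metis alg_norm_1 alg_norm_mult dvdE mult_zero_left zero_neq_one)

lemma degree_alg_char_poly: "degree (alg_char_poly scale x) = rank"
  and monic_alg_char_poly: "monic (alg_char_poly scale x)"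
  using degree_monic_char_poly[OF mult_matrix_carrier[of x]] by (simp_all add: alg_char_poly_def)

lemma mult_basis_eq_sum_mult_matrix:
  assumes "j < rank"
  shows "x * alg_basis scale ! j =
    (\<Sum>i<rank. scale (mult_matrix scale x $$ (i, j)) (alg_basis scale ! i))"
proof -
  let ?bs = "alg_basis scale"
  have "(\<Sum>i<rank. scale (mult_matrix scale x $$ (i, j)) (?bs ! i)) =
      (\<Sum>i<length ?bs. scale (representation (set ?bs) (x * ?bs ! j) (?bs ! i)) (?bs ! i))"
    using assms basis_list_length[OF basis_list_alg_basis]
    by (simp add: mult_matrix_eq_lin_matrix lin_matrix_def)
  also have "\<dots> = (\<Sum>b\<in>set ?bs. scale (representation (set ?bs) (x * ?bs ! j) b) b)"
    by (rule sum_nth_basis_list[OF basis_list_alg_basis])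
  also have "\<dots> = x * ?bs ! j"
    using basis_list_alg_basis by (intro sum_representation_eq) (auto simp: basis_list_def)
  finally show ?thesis by (rule sym)
qed

text \<open>The matrix \<open>x I - M\<close> over the algebra kills the basis vector, hence so does its determinant.\<close>

theorem alg_eval_alg_char_poly: "alg_eval scale (alg_char_poly scale x) x = 0"
proof -
  let ?bs = "alg_basis scale" and ?M = "mult_matrix scale x"
  let ?A = "map_mat (\<lambda>p. alg_eval scale p x) (char_poly_matrix ?M)"
  let ?d = "alg_eval scale (alg_char_poly scale x) x"
  interpret mult: Vector_Spaces.linear scale scale "(*) ?d"
    by (rule linear_mult)
  have length: "length ?bs = rank" and span: "span (set ?bs) = UNIV"
    using basis_list_alg_basis basis_list_length by (auto simp: basis_list_def)
  have dim_M: "dim_row ?M = rank" "dim_col ?M = rank"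
    using mult_matrix_carrier[of x] by auto
  have carrier_A: "?A \<in> carrier_mat rank rank"
    using mult_matrix_carrier by simp
  have A_entry: "?A $$ (i, j) = (if i = j then x else 0) - scale (?M $$ (i, j)) 1"
    if "i < rank" "j < rank" for i j
    using that by (simp add: char_poly_matrix_def dim_M alg_eval_pCons)
  have "(\<Sum>i<rank. ?A $$ (i, j) * ?bs ! i) = 0" if "j < rank" for j
  proof -
    have "(\<Sum>i<rank. ?A $$ (i, j) * ?bs ! i) =
        (\<Sum>i<rank. (if i = j then x * ?bs ! i else 0) - scale (?M $$ (i, j)) (?bs ! i))"
      using that by (intro sum.cong)
        (auto simp: A_entry left_diff_distrib simp flip: scale_mult_left)
    then show ?thesis
      using that by (simp add: sum_subtractf sum.delta mult_basis_eq_sum_mult_matrix)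
  qed
  then have "transpose_mat ?A *\<^sub>v vec_of_list ?bs = 0\<^sub>v rank"
    using carrier_A length
    by (intro eq_vecI) (auto simp: scalar_prod_def lessThan_atLeast0 vec_of_list_index)
  then have "?d * ?bs ! i = 0" if "i < rank" for i
    using that carrier_A length
      det_mult_vec_index_eq_0[of "transpose_mat ?A" rank "vec_of_list ?bs" i]
    by (simp add: alg_char_poly_def char_poly_def det_transpose vec_of_list_index carrier_vecI)
  then have "?d * b = 0" if "b \<in> set ?bs" for b
    using that length by (metis in_set_conv_nth)
  then have "?d * 1 = 0"
    using mult.eq_0_on_span[of "set ?bs" 1] span by simp
  then show ?thesis by simp
qed

lemma finite_algebra: "finite (UNIV :: 'a set) \<Longrightarrow> finite (UNIV :: 'b set)"
  using finite_spanning_set finite_span by metis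

end

section \<open>Monogenic algebras\<close>

locale monogenic_algebra = finite_dim_comm_algebra +
  fixes w :: 'b
  assumes generates: "generates_algebra scale w"
begin

abbreviation \<chi> :: "'a poly" where "\<chi> \<equiv> alg_char_poly scale w"

lemma char_poly_nonzero: "\<chi> \<noteq> 0"
  using monic_alg_char_poly[of w] by auto

lemma alg_eval_mod_char_poly: "alg_eval scale (p mod \<chi>) w = alg_eval scale p w"
proof -
  have "alg_eval scale p w = alg_eval scale (p div \<chi> * \<chi> + p mod \<chi>) w"
    by (simp only: div_mult_mod_eq)
  then show ?thesis
    by (simp only: alg_eval.hom_add alg_eval.hom_mult alg_eval_alg_char_poly mult_zero_right add_0)
qed

lemma alg_eval_as_sum_mod:
  "alg_eval scale p w = (\<Sum>i<rank. scale (coeff (p mod \<chi>) i) (w ^ i))"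
  using alg_eval_as_sum[of rank "p mod \<chi>" w] coeff_mod_eq_0[OF char_poly_nonzero]
  by (simp add: alg_eval_mod_char_poly degree_alg_char_poly)

lemma alg_eval_cases: obtains p where "u = alg_eval scale p w"
  using generates_algebra_imp_alg_eval_surj[OF generates] by (metis surjD)

definition power_basis :: "'b list" where
  "power_basis = map (\<lambda>i. w ^ (rank - Suc i)) [0..<rank]"

lemma set_power_basis: "set power_basis = (^) w ` {..<rank}"
proof -
  have "j \<in> (\<lambda>i. rank - Suc i) ` {..<rank}" if "j < rank" for j
    using that by (intro image_eqI[of _ _ "rank - Suc j"]) auto
  then show ?thesis
    by (fastforce simp: power_basis_def)
qed

lemma basis_list_power_basis: "basis_list scale power_basis"
proof (rule basis_list_if_spanning)
  have "u \<in> span (set power_basis)" for u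
  proof -
    obtain p where "u = alg_eval scale p w"
      by (rule alg_eval_cases)
    then show ?thesis
      unfolding set_power_basis
      by (auto simp: alg_eval_as_sum_mod intro!: span_sum span_scale intro: span_base)
  qed
  then show "span (set power_basis) = UNIV" by blast
qed (simp add: power_basis_def)

lemma inj_on_power: "inj_on ((^) w) {..<rank}"
proof (rule eq_card_imp_inj_on)
  show "card ((^) w ` {..<rank}) = card {..<rank}"
    using basis_list_power_basis basis_list_length[OF basis_list_power_basis]
    by (simp add: basis_list_def distinct_card flip: set_power_basis)
qed simp

definition power_coeff :: "nat \<Rightarrow> 'b \<Rightarrow> 'a" where
  "power_coeff i u = representation (set power_basis) u (w ^ i)"

lemma power_coeff_sum: "power_coeff i (\<Sum>j\<in>J. h j) = (\<Sum>j\<in>J. power_coeff i (h j))"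
  and power_coeff_add: "power_coeff i (u + v) = power_coeff i u + power_coeff i v"
  and power_coeff_scale: "power_coeff i (scale c u) = c * power_coeff i u"
  using basis_list_power_basis
  by (simp_all add: power_coeff_def basis_list_def
      representation_sum representation_add representation_scale)

lemma power_coeff_power:
  assumes "i < rank" "j < rank"
  shows "power_coeff i (w ^ j) = (if i = j then 1 else 0)"
  using assms basis_list_power_basis inj_onD[OF inj_on_power, of i j]
  by (auto simp: power_coeff_def basis_list_def set_power_basis representation_basis)

lemma power_coeff_alg_eval:
  "i < rank \<Longrightarrow> power_coeff i (alg_eval scale p w) = coeff (p mod \<chi>) i"
  by (simp add: alg_eval_as_sum_mod power_coeff_sum power_coeff_scale power_coeff_power
      if_distrib sum.delta cong: if_cong)

lemma sum_power_coeff: "u = (\<Sum>i<rank. scale (power_coeff i u) (w ^ i))"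
proof -
  obtain p where u: "u = alg_eval scale p w"
    by (rule alg_eval_cases)
  show ?thesis
    unfolding u by (subst alg_eval_as_sum_mod) (simp add: power_coeff_alg_eval)
qed

lemma rank_pos: "rank > 0"
  using sum_power_coeff[of 1] by (auto intro: Nat.gr0I)

lemma alg_eval_eq_0_iff: "alg_eval scale p w = 0 \<longleftrightarrow> \<chi> dvd p"
proof
  assume zero: "alg_eval scale p w = 0"
  have "coeff (p mod \<chi>) i = 0" for i
  proof (cases "i < rank")
    case True
    then have "coeff (p mod \<chi>) i = power_coeff i (scale 0 1)"
      using power_coeff_alg_eval[of i p] zero by simp
    then show ?thesis
      by (simp only: power_coeff_scale mult_zero_left)
  qed (simp add: coeff_mod_eq_0[OF char_poly_nonzero] degree_alg_char_poly)
  then show "\<chi> dvd p"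
    by (simp add: poly_eq_iff mod_eq_0_iff_dvd[symmetric])
next
  assume "\<chi> dvd p"
  then show "alg_eval scale p w = 0"
    by (auto simp: alg_eval.hom_mult alg_eval_alg_char_poly elim!: dvdE)
qed

theorem alg_norm_alg_eval: "alg_norm scale (alg_eval scale p w) = resultant \<chi> p"
proof -
  let ?R = "coeff_mat rank rank (\<lambda>i. monom 1 (rank - Suc i) * p mod \<chi>)"
  have "lin_matrix scale power_basis power_basis ((*) (alg_eval scale p w)) = transpose_mat ?R"
  proof (rule eq_matI)
    fix i j assume "i < dim_row (transpose_mat ?R)" "j < dim_col (transpose_mat ?R)"
    then have ij: "i < rank" "j < rank" by simp_all
    have "alg_eval scale p w * w ^ (rank - Suc j) = alg_eval scale (monom 1 (rank - Suc j) * p) w"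
      by (simp add: alg_eval.hom_mult alg_eval_monom)
    then show "lin_matrix scale power_basis power_basis ((*) (alg_eval scale p w)) $$ (i, j) =
        transpose_mat ?R $$ (i, j)"
      using ij power_coeff_alg_eval[of "rank - Suc i" "monom 1 (rank - Suc j) * p"]
      by (simp add: lin_matrix_def coeff_mat_def power_coeff_def) (simp add: power_basis_def)
  qed (simp_all add: lin_matrix_def power_basis_def)
  then show ?thesis
    using det_transpose[of ?R rank] resultant_monic_eq_det_residues[OF monic_alg_char_poly, of w p]
    by (simp add: alg_norm_eq_det_lin_matrix[OF basis_list_power_basis] degree_alg_char_poly)
qed

abbreviation different :: 'b where "different \<equiv> alg_eval scale (pderiv \<chi>) w"

lemma alg_norm_different:
  "alg_norm scale different = (-1) ^ (rank * (rank - 1) div 2) * elem_disc scale w"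
  by (simp add: alg_norm_alg_eval elem_disc_def poly_disc_def degree_alg_char_poly
      monic_alg_char_poly[unfolded degree_alg_char_poly] flip: power_add mult.assoc)

lemma power_coeff_Suc_mult:
  assumes "Suc i < rank"
  shows "power_coeff (Suc i) (w * u) = power_coeff i u - coeff \<chi> (Suc i) * power_coeff (rank - 1) u"
proof -
  obtain p where u: "u = alg_eval scale p w"
    by (rule alg_eval_cases)
  have "w * u = alg_eval scale (pCons 0 p) w"
    by (simp add: u alg_eval_pCons)
  moreover have "coeff (pCons 0 (p mod \<chi>)) rank = coeff (p mod \<chi>) (rank - 1)"
    using assms by (simp add: coeff_pCons split: nat.split)
  ultimately show ?thesis
    using assms monic_alg_char_poly[of w] unfolding u
    by (simp add: power_coeff_alg_eval mod_pCons[OF char_poly_nonzero] degree_alg_char_poly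
        mult.commute)
qed

text \<open>The values at \<open>w\<close> of the polynomials \<open>poly_shift (Suc i) \<chi>\<close> are the basis dual to
  \<open>1, w, \<dots>, w\<^sup>n\<^sup>-\<^sup>1\<close> with respect to the form \<open>(u, v) \<mapsto> power_coeff (n - 1) (u * v)\<close>.\<close>

lemma power_coeff_eq_top_coeff:
  assumes "i < rank"
  shows "power_coeff i u = power_coeff (rank - 1) (u * alg_eval scale (poly_shift (Suc i) \<chi>) w)"
proof -
  from assms have "i \<le> rank - 1" by simp
  then show ?thesis
  proof (induction i arbitrary: u rule: inc_induct)
    case base
    have "poly_shift rank \<chi> = 1"
      using degree_alg_char_poly[of w] monic_alg_char_poly[of w]
      by (intro poly_eqI) (auto simp: coeff_poly_shift coeff_eq_0)
    then show ?case
      using rank_pos by simp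
  next
    case (step i)
    let ?b = "alg_eval scale (poly_shift (Suc (Suc i)) \<chi>) w"
    have "power_coeff i u =
        power_coeff (Suc i) (w * u) + coeff \<chi> (Suc i) * power_coeff (rank - 1) u"
      using step.hyps by (simp add: power_coeff_Suc_mult)
    also have "\<dots> = power_coeff (rank - 1) (w * u * ?b + scale (coeff \<chi> (Suc i)) u)"
      using step.IH by (simp add: power_coeff_add power_coeff_scale)
    also have "w * u * ?b + scale (coeff \<chi> (Suc i)) u = u * alg_eval scale (poly_shift (Suc i) \<chi>) w"
      by (subst (2) poly_shift_Suc) (simp add: alg_eval_pCons algebra_simps flip: scale_mult_right)
    finally show ?case .
  qed
qed

theorem alg_trace_eq_top_coeff: "alg_trace scale h = power_coeff (rank - 1) (h * different)"
proof -
  have "alg_trace scale h = (\<Sum>i<rank. power_coeff i (h * w ^ i))"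
    unfolding alg_trace_eq_sum_representation[OF basis_list_power_basis] power_coeff_def
    by (simp add: set_power_basis sum.reindex[OF inj_on_power])
  also have "\<dots> = (\<Sum>i<rank. power_coeff (rank - 1)
      (h * alg_eval scale (monom 1 i * poly_shift (Suc i) \<chi>) w))"
    by (intro sum.cong refl, subst power_coeff_eq_top_coeff)
      (simp_all add: alg_eval.hom_mult alg_eval_monom mult.assoc)
  also have "\<dots> = power_coeff (rank - 1) (h * different)"
    by (simp add: pderiv_eq_sum_poly_shift degree_alg_char_poly alg_eval.hom_sum
        sum_distrib_left power_coeff_sum)
  finally show ?thesis .
qed

lemma top_coeffs_zero_iff_scalar:
  "(\<forall>i<rank - 1. power_coeff (rank - 1) (w ^ i * u) = 0) \<longleftrightarrow> (\<exists>c. u = scale c 1)"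
proof
  assume top: "\<forall>i<rank - 1. power_coeff (rank - 1) (w ^ i * u) = 0"
  have "power_coeff j u = 0" if "j < rank" "j \<noteq> 0" for j
  proof -
    have "alg_eval scale (poly_shift (Suc j) \<chi>) w =
        (\<Sum>i<rank - 1. scale (coeff (poly_shift (Suc j) \<chi>) i) (w ^ i))"
      using that by (intro alg_eval_as_sum)
        (simp add: coeff_poly_shift coeff_eq_0 degree_alg_char_poly)
    then have "power_coeff j u =
        power_coeff (rank - 1) (\<Sum>i<rank - 1. scale (coeff (poly_shift (Suc j) \<chi>) i) (w ^ i * u))"
      using power_coeff_eq_top_coeff[OF that(1), of u]
      by (simp add: sum_distrib_left mult.commute[of u] flip: scale_mult_right)
    then show ?thesis
      using top by (simp add: power_coeff_sum power_coeff_scale)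
  qed
  then have "u = scale (power_coeff 0 u) 1"
    using sum_power_coeff[of u] rank_pos by (simp add: sum.remove[of _ 0])
  then show "\<exists>c. u = scale c 1" ..
next
  assume "\<exists>c. u = scale c 1"
  then show "\<forall>i<rank - 1. power_coeff (rank - 1) (w ^ i * u) = 0"
    by (auto simp: power_coeff_scale power_coeff_power simp flip: scale_mult_right)
qed

corollary trace_orthogonal_iff:
  "(\<forall>i<rank - 1. alg_trace scale (w ^ i * h) = 0) \<longleftrightarrow> (\<exists>c. h * different = scale c 1)"
  by (simp add: alg_trace_eq_top_coeff mult.assoc flip: top_coeffs_zero_iff_scalar)

end

section \<open>Etale algebras\<close>

lemma is_unit_if_unit_mod_idempotents:
  fixes d :: "'b::comm_ring_1"
  assumes "\<Sum>E = 1" and "\<And>e. e \<in> E \<Longrightarrow> \<exists>y. e * d * y = e"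
  shows "d dvd 1"
proof -
  obtain y where y: "\<And>e. e \<in> E \<Longrightarrow> e * d * y e = e"
    using assms(2) by metis
  have "d * (\<Sum>e\<in>E. e * y e) = (\<Sum>e\<in>E. e * d * y e)"
    by (simp add: sum_distrib_left algebra_simps)
  also have "\<dots> = 1"
    using y assms(1) by simp
  finally show ?thesis by (metis dvd_triv_left)
qed

lemma separable_field_factor_inverse:
  assumes "separable_field_factor scale e" "e * x \<noteq> 0"
  obtains y where "e * x * y = e"
  using assms unfolding separable_field_factor_def by (metis rangeI)

lemma reduced_if_field_factors:
  fixes x :: "'b::comm_ring_1" and E :: "'b set"
  assumes sum: "\<Sum>E = 1" and E: "\<And>e. e \<in> E \<Longrightarrow> separable_field_factor scale e" and "x * x = 0"
  shows "x = 0"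
proof -
  have "e * x = 0" if "e \<in> E" for e
  proof (rule ccontr)
    assume "e * x \<noteq> 0"
    then obtain y where y: "e * x * y = e"
      using separable_field_factor_inverse[OF E[OF \<open>e \<in> E\<close>]] by blast
    have "e * x = e * x * y * x" using y by simp
    also have "\<dots> = e * y * (x * x)" by (simp add: algebra_simps)
    finally show False using \<open>e * x \<noteq> 0\<close> \<open>x * x = 0\<close> by simp
  qed
  then have "(\<Sum>e\<in>E. e * x) = 0" by simp
  then show ?thesis
    using sum by (simp flip: sum_distrib_right)
qed

lemma (in comm_algebra) irreducible_annihilator_dvd:
  assumes "irreducible p" "e \<noteq> 0" "e * alg_eval scale p x = 0" "e * alg_eval scale q x = 0"
  shows "p dvd q"
proof (rule irreducible_dvd_ideal)
  let ?I = "{r. e * alg_eval scale r x = 0}"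
  show "r + s \<in> ?I" if "r \<in> ?I" "s \<in> ?I" for r s
    using that by (simp add: alg_eval.hom_add distrib_left)
  show "s * r \<in> ?I" if "r \<in> ?I" for r s
    using that by (simp add: alg_eval.hom_mult mult.left_commute[of e])
qed (use assms in simp_all)

context monogenic_algebra
begin

lemma square_not_dvd_char_poly_if_reduced:
  assumes reduced: "\<And>x :: 'b. x * x = 0 \<Longrightarrow> x = 0" and "irreducible p"
  shows "\<not> p * p dvd \<chi>"
proof
  assume "p * p dvd \<chi>"
  then obtain k where k: "\<chi> = p * p * k" by (elim dvdE)
  have "alg_eval scale (p * k) w * alg_eval scale (p * k) w = alg_eval scale (\<chi> * k) w"
    unfolding alg_eval.hom_mult[symmetric] by (simp add: k mult_ac)
  also have "\<dots> = 0"
    by (simp add: alg_eval_eq_0_iff)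
  finally have "\<chi> dvd p * k"
    using reduced alg_eval_eq_0_iff by blast
  then have "p * (p * k) dvd 1 * (p * k)"
    by (simp add: k mult.assoc)
  then have "p * k = 0 \<or> p dvd 1"
    by (simp only: dvd_mult_cancel_right)
  moreover have "p * k \<noteq> 0"
    using k char_poly_nonzero by auto
  ultimately show False
    using \<open>irreducible p\<close> unfolding irreducible_def by blast
qed

lemma field_factor_mult_different_nonzero:
  assumes reduced: "\<And>x :: 'b. x * x = 0 \<Longrightarrow> x = 0" and e: "separable_field_factor scale e"
  shows "e * different \<noteq> 0"
proof
  assume different: "e * different = 0"
  have idem: "e * e = e" "e \<noteq> 0"
    and "\<exists>p. irreducible p \<and> e * alg_eval scale p (e * w) = 0 \<and> coprime p (pderiv p)"
    using e by (auto simp: separable_field_factor_def)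
  then obtain p where p: "irreducible p" "e * alg_eval scale p w = 0" "coprime p (pderiv p)"
    using alg_eval_mult_idempotent[OF idem(1)] by auto
  note p_dvd = irreducible_annihilator_dvd[OF p(1) idem(2) p(2)]
  have "p dvd \<chi>" "p dvd pderiv \<chi>"
    using different by (auto intro: p_dvd simp: alg_eval_alg_char_poly)
  then have "p * p dvd \<chi>"
    by (rule square_dvd_if_dvd_pderiv[OF p(1,3)])
  with square_not_dvd_char_poly_if_reduced[OF reduced p(1)] show False by blast
qed

theorem different_unit_if_etale:
  assumes "finite_etale_algebra scale"
  shows "different dvd 1"
proof -
  obtain E where sum: "\<Sum>E = 1" and E: "\<And>e. e \<in> E \<Longrightarrow> separable_field_factor scale e"
    using assms by (auto simp: finite_etale_algebra_def)
  have "\<exists>y. e * different * y = e" if "e \<in> E" for e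
    using separable_field_factor_inverse[OF E[OF that]]
      field_factor_mult_different_nonzero[OF reduced_if_field_factors[OF sum E] E[OF that]]
    by metis
  then show ?thesis
    by (rule is_unit_if_unit_mod_idempotents[OF sum])
qed

end

section \<open>Roots in finite fields\<close>

lemma power_card_minus_1_eq_1:
  fixes x :: "'k::{field,finite}"
  assumes "x \<noteq> 0"
  shows "x ^ (CARD('k) - 1) = 1"
proof -
  let ?U = "UNIV - {0 :: 'k}"
  have "bij_betw ((*) x) ?U ?U"
    using assms by (intro bij_betwI[where g = "\<lambda>y. y / x"]) auto
  then have "(\<Prod>y\<in>?U. x * y) = \<Prod>?U"
    by (rule prod.reindex_bij_betw)
  then have "x ^ card ?U * \<Prod>?U = \<Prod>?U"
    by (simp add: prod.distrib)
  moreover have "\<Prod>?U \<noteq> 0" by simp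
  ultimately show ?thesis by (simp add: card_Diff_singleton)
qed

lemma card_nonzero_roots_coprime:
  fixes d :: "'k::{field,finite}"
  assumes "coprime n (CARD('k) - 1)" "n > 0" "d \<noteq> 0"
  shows "card {u. u \<noteq> 0 \<and> u ^ n = d} = 1"
proof -
  let ?U = "UNIV - {0 :: 'k}"
  obtain a b where ab: "n * a = (CARD('k) - 1) * b + 1"
    using bezout_nat[of n "CARD('k) - 1"] assms(1,2) by auto
  have inverse: "(u ^ n) ^ a = u" if "u \<noteq> 0" for u :: 'k
  proof -
    have "(u ^ n) ^ a = (u ^ (CARD('k) - 1)) ^ b * u"
      unfolding power_mult[symmetric] ab by simp
    then show ?thesis
      using power_card_minus_1_eq_1[OF that] by simp
  qed
  have inj: "inj_on (\<lambda>u. u ^ n) ?U"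
    by (rule inj_on_inverseI[where g = "\<lambda>u. u ^ a"]) (simp add: inverse)
  moreover have "(\<lambda>u. u ^ n) ` ?U \<subseteq> ?U" by auto
  ultimately have "(\<lambda>u. u ^ n) ` ?U = ?U"
    by (intro endo_inj_surj) auto
  then have "d \<in> (\<lambda>u. u ^ n) ` ?U"
    using assms(3) by simp
  then obtain v where "v \<noteq> 0" "v ^ n = d" by auto
  then have "{u. u \<noteq> 0 \<and> u ^ n = d} = {v}"
    using inj_onD[OF inj] by auto
  then show ?thesis by simp
qed

lemma card_roots_of_unity_le:
  assumes "n > 0"
  shows "card {x :: 'a::idom. x ^ n = 1} \<le> n"
proof -
  let ?f = "monom 1 n - 1 :: 'a poly"
  have "poly ?f 0 \<noteq> 0"
    using assms by (simp add: poly_monom zero_power)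
  then have "?f \<noteq> 0" by auto
  from card_poly_roots_bound[OF this] have "card {x :: 'a. x ^ n = 1} \<le> degree ?f"
    by (simp add: poly_monom)
  also have "degree ?f \<le> n"
    by (intro degree_diff_le) (auto simp: degree_monom_le)
  finally show ?thesis .
qed

lemma card_roots_geometric_sum_le:
  assumes "n > 0"
  shows "card {x :: 'a::idom. (\<Sum>i\<le>m. (x ^ n) ^ i) = 0} \<le> n * m"
proof -
  let ?g = "\<Sum>i\<le>m. monom 1 (n * i) :: 'a poly"
  have "coeff ?g 0 = 1"
    using assms by (simp add: coeff_sum)
  then have "?g \<noteq> 0" by auto
  from card_poly_roots_bound[OF this]
  have "card {x :: 'a. (\<Sum>i\<le>m. (x ^ n) ^ i) = 0} \<le> degree ?g"
    by (simp add: poly_sum poly_monom power_mult)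
  also have "degree ?g \<le> n * m"
    by (intro degree_sum_le) (auto intro: order.trans[OF degree_monom_le])
  finally show ?thesis .
qed

text \<open>The \<open>q - 1\<close> units are roots of \<open>x\<^sup>q\<^sup>-\<^sup>1 - 1\<close>, which is the product of \<open>x\<^sup>n - 1\<close> and a
  polynomial of degree \<open>q - 1 - n\<close>.\<close>

lemma card_roots_of_unity_dvd:
  assumes "n dvd CARD('k::{field,finite}) - 1"
  shows "card {x :: 'k. x ^ n = 1} = n"
proof -
  have "card {0, 1 :: 'k} \<le> CARD('k)" by (rule card_mono) auto
  moreover obtain k where k: "CARD('k) - 1 = n * k"
    using assms by (elim dvdE)
  ultimately have "n > 0" and "\<exists>m. k = Suc m"
    by (auto intro!: gr0I gr0_implies_Suc)
  then obtain m where m: "CARD('k) - 1 = n * Suc m"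
    using k by auto
  let ?roots_f = "{x :: 'k. x ^ n = 1}" and ?roots_g = "{x :: 'k. (\<Sum>i\<le>m. (x ^ n) ^ i) = 0}"
  have "UNIV - {0} \<subseteq> ?roots_f \<union> ?roots_g"
  proof
    fix x :: 'k assume "x \<in> UNIV - {0}"
    then have "x ^ (n * Suc m) = 1"
      unfolding m[symmetric] by (intro power_card_minus_1_eq_1) simp
    then have "(x ^ n - 1) * (\<Sum>i<Suc m. (x ^ n) ^ i) = 0"
      by (simp only: power_mult diff_self flip: power_diff_1_eq)
    then show "x \<in> ?roots_f \<union> ?roots_g"
      by (simp add: lessThan_Suc_atMost del: sum.lessThan_Suc)
  qed
  then have "card (UNIV - {0 :: 'k}) \<le> card ?roots_f + card ?roots_g"
    using card_mono[OF finite] card_Un_le order.trans by blast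
  moreover have "card (UNIV - {0 :: 'k}) = n * m + n"
    using m by (simp add: card_Diff_singleton)
  ultimately show ?thesis
    using card_roots_of_unity_le[OF \<open>n > 0\<close>, where ?'a = 'k]
      card_roots_geometric_sum_le[OF \<open>n > 0\<close>, where ?'a = 'k and m = m]
    by linarith
qed

lemma card_roots_eq_card_roots_of_unity:
  fixes v :: "'k::field"
  assumes "v \<noteq> 0" "n > 0"
  shows "card {u. u \<noteq> 0 \<and> u ^ n = v ^ n} = card {x :: 'k. x ^ n = 1}"
proof -
  have "bij_betw (\<lambda>x. x * v) {x. x ^ n = 1} {u. u \<noteq> 0 \<and> u ^ n = v ^ n}"
  proof (rule bij_betwI)
    have "x \<noteq> 0" if "x ^ n = 1" for x :: 'k
      using that assms(2) by (auto simp: zero_power)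
    then show "(\<lambda>x. x * v) \<in> {x. x ^ n = 1} \<rightarrow> {u. u \<noteq> 0 \<and> u ^ n = v ^ n}"
      using assms(1) by (intro Pi_I) (simp add: power_mult_distrib)
    show "(\<lambda>u. u / v) \<in> {u. u \<noteq> 0 \<and> u ^ n = v ^ n} \<rightarrow> {x. x ^ n = 1}"
      using assms(1) by (intro Pi_I) (simp add: power_divide)
  qed (use assms(1) in simp_all)
  from bij_betw_same_card[OF this] show ?thesis
    by (rule sym)
qed

lemma card_nonzero_cube_roots:
  fixes d :: "'k::{field,finite}"
  shows "CARD('k) mod 3 = 2 \<Longrightarrow> d \<noteq> 0 \<Longrightarrow> card {u. u \<noteq> 0 \<and> u ^ 3 = d} = 1"
    and "CARD('k) mod 3 = 1 \<Longrightarrow> d \<in> {u ^ 3 | u. u \<noteq> 0} \<Longrightarrow> card {u. u \<noteq> 0 \<and> u ^ 3 = d} = 3"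
    and "d \<notin> {u ^ 3 | u. u \<noteq> 0} \<Longrightarrow> card {u. u \<noteq> 0 \<and> u ^ 3 = d} = 0"
proof -
  assume "CARD('k) mod 3 = 2" and "d \<noteq> 0"
  then have "\<not> 3 dvd CARD('k) - 1" by presburger
  then have "coprime 3 (CARD('k) - 1)"
    by (simp add: prime_imp_coprime)
  then show "card {u. u \<noteq> 0 \<and> u ^ 3 = d} = 1"
    using \<open>d \<noteq> 0\<close> by (simp add: card_nonzero_roots_coprime)
next
  assume "CARD('k) mod 3 = 1" and d: "d \<in> {u ^ 3 | u. u \<noteq> 0}"
  then have "3 dvd CARD('k) - 1" by presburger
  then show "card {u. u \<noteq> 0 \<and> u ^ 3 = d} = 3"
    using d by (auto simp: card_roots_eq_card_roots_of_unity card_roots_of_unity_dvd)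
next
  assume "d \<notin> {u ^ 3 | u. u \<noteq> 0}"
  then have "{u. u \<noteq> 0 \<and> u ^ 3 = d} = {}" by force
  then show "card {u. u \<noteq> 0 \<and> u ^ 3 = d} = 0"
    by (simp only: card.empty)
qed

section \<open>Counting elements orthogonal to powers of the generator\<close>

lemma (in comm_algebra) scale_is_unit_iff:
  assumes "v dvd 1"
  shows "scale c v dvd 1 \<longleftrightarrow> c \<noteq> 0"
proof
  assume "c \<noteq> 0"
  then have "scale c v * scale (1 / c) x = v * x" for x
    by (simp flip: scale_mult_left scale_mult_right)
  then show "scale c v dvd 1"
    using assms by (metis dvdE dvd_triv_left)
qed (auto elim: dvdE)

lemma (in comm_algebra) mult_eq_scalar_iff:
  assumes "d * v = 1"
  shows "h * d = scale c 1 \<longleftrightarrow> h = scale c v"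
proof
  assume "h * d = scale c 1"
  then have "h * (d * v) = scale c v"
    by (simp add: mult.assoc[symmetric] flip: scale_mult_left)
  then show "h = scale c v" using assms by simp
next
  assume "h = scale c v"
  then show "h * d = scale c 1"
    using assms by (simp add: mult.commute[of v] flip: scale_mult_left)
qed

theorem (in monogenic_algebra) card_trace_orthogonal_norm_fiber:
  assumes "\<gamma> dvd 1" "different dvd 1"
  shows "card {h. h dvd 1 \<and> alg_norm scale h = \<delta> \<and>
      (\<forall>i<rank - 1. alg_trace scale (w ^ i * (\<gamma> * h)) = 0)} =
    card {u. u \<noteq> 0 \<and> u ^ rank = alg_norm scale \<gamma> * \<delta> * alg_norm scale different}"
    (is "card ?H = card ?U")
proof -
  have "\<gamma> * different dvd 1"
    using assms by (metis mult_1_left mult_dvd_mono)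
  then obtain v where v: "\<gamma> * different * v = 1" by (metis dvdE)
  then have "v dvd 1" by (metis dvd_triv_right)
  have norm_v: "alg_norm scale v = 1 / (alg_norm scale \<gamma> * alg_norm scale different)"
    using arg_cong[OF v, of "alg_norm scale"]
    by (auto simp: alg_norm_mult alg_norm_1 eq_divide_eq mult_ac)
  have "?H = {h. h dvd 1 \<and> alg_norm scale h = \<delta> \<and> (\<exists>c. h = scale c v)}"
    unfolding trace_orthogonal_iff mult_eq_scalar_iff[OF v, symmetric]
    by (simp only: mult_ac)
  also have "\<dots> = {scale u v | u. u \<noteq> 0 \<and> u ^ rank * alg_norm scale v = \<delta>}"
    by (auto simp: scale_is_unit_iff[OF \<open>v dvd 1\<close>] alg_norm_scale)
  also have "\<dots> = (\<lambda>u. scale u v) ` ?U"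
  proof -
    have "u ^ rank * alg_norm scale v = \<delta> \<longleftrightarrow>
        u ^ rank = alg_norm scale \<gamma> * \<delta> * alg_norm scale different" for u
      using assms[THEN alg_norm_unit_nonzero] by (auto simp: norm_v field_simps)
    then show ?thesis by auto
  qed
  finally have "?H = (\<lambda>u. scale u v) ` ?U" .
  moreover have "inj_on (\<lambda>u. scale u v) ?U"
    using v by (intro inj_onI) auto
  ultimately show ?thesis
    by (simp only: card_image)
qed

lemma (in monogenic_algebra) card_X_sing_fiber:
  assumes "rank = 3" "\<gamma> dvd 1" "different dvd 1"
  shows "card (X_sing scale w {\<delta>} \<gamma>) =
    card {u. u \<noteq> 0 \<and> u ^ 3 = - (alg_norm scale \<gamma> * \<delta> * elem_disc scale w)}"
proof -
  have "X_sing scale w {\<delta>} \<gamma> =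
      {h. h dvd 1 \<and> alg_norm scale h = \<delta> \<and> (\<forall>i<rank - 1. alg_trace scale (w ^ i * (\<gamma> * h)) = 0)}"
    using assms(1) by (auto simp: X_sing_def X_set_def less_2_cases_iff mult.assoc)
  then show ?thesis
    using card_trace_orthogonal_norm_fiber[OF assms(2,3), of \<delta>] assms(1)
    by (simp add: alg_norm_different)
qed

context finite_dim_comm_algebra
begin

lemma card_X_set_fiber:
  assumes "\<gamma> dvd 1"
  shows "card (X_set scale {\<delta>} \<gamma>) = trace_zero_count scale (alg_norm scale \<gamma> * \<delta>)"
proof -
  obtain v where v: "\<gamma> * v = 1" using assms by (metis dvdE)
  have inverse: "\<gamma> * (v * x) = x" "v * (\<gamma> * x) = x" for x
    using v by (simp_all add: mult.commute[of v \<gamma>] flip: mult.assoc)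
  define T where
    "T = {x. x dvd 1 \<and> alg_trace scale x = 0 \<and> alg_norm scale x = alg_norm scale \<gamma> * \<delta>}"
  have mem: "h \<in> X_set scale {\<delta>} \<gamma> \<longleftrightarrow> \<gamma> * h \<in> T" for h
    using alg_norm_unit_nonzero[OF assms] assms by (auto simp: X_set_def T_def alg_norm_mult)
  have "bij_betw ((*) \<gamma>) (X_set scale {\<delta>} \<gamma>) T"
    by (rule bij_betwI[where g = "(*) v"]) (auto simp: mem inverse)
  then show ?thesis
    unfolding trace_zero_count_def T_def by (rule bij_betw_same_card)
qed

lemma
  assumes "finite (UNIV :: 'a set)"
  shows card_X_set_eq_sum_fibers: "card (X_set scale C \<gamma>) = (\<Sum>\<delta>\<in>C. card (X_set scale {\<delta>} \<gamma>))"
    and card_X_sing_eq_sum_fibers: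
      "card (X_sing scale \<omega> C \<gamma>) = (\<Sum>\<delta>\<in>C. card (X_sing scale \<omega> {\<delta>} \<gamma>))"
proof -
  have finite: "finite C" "finite (A :: 'b set)" for A
    using finite_subset[OF subset_UNIV] assms finite_algebra by blast+
  have "X_set scale C \<gamma> = (\<Union>\<delta>\<in>C. X_set scale {\<delta>} \<gamma>)"
    and "X_sing scale \<omega> C \<gamma> = (\<Union>\<delta>\<in>C. X_sing scale \<omega> {\<delta>} \<gamma>)"
    by (auto simp: X_set_def X_sing_def)
  then show "card (X_set scale C \<gamma>) = (\<Sum>\<delta>\<in>C. card (X_set scale {\<delta>} \<gamma>))"
    and "card (X_sing scale \<omega> C \<gamma>) = (\<Sum>\<delta>\<in>C. card (X_sing scale \<omega> {\<delta>} \<gamma>))"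
    using finite by (auto simp: X_set_def X_sing_def intro!: card_UN_disjoint)
qed

lemma card_X_set_diff_X_sing:
  assumes "finite (UNIV :: 'a set)"
  shows "int (card (X_set scale C \<gamma> - X_sing scale \<omega> C \<gamma>)) =
    int (card (X_set scale C \<gamma>)) - int (card (X_sing scale \<omega> C \<gamma>))"
proof -
  have finite: "finite (A :: 'b set)" for A
    using finite_subset[OF subset_UNIV finite_algebra[OF assms]] .
  have "X_sing scale \<omega> C \<gamma> \<subseteq> X_set scale C \<gamma>"
    by (auto simp: X_sing_def)
  then show ?thesis
    by (simp add: card_Diff_subset card_mono finite of_nat_diff)
qed

end

theorem theorem4p4:
  fixes scale :: "'k::{field,finite} \<Rightarrow> 'b::comm_ring_1 \<Rightarrow> 'b"
    and \<gamma> \<omega> :: 'b and C :: "'k set"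
  assumes "finite_etale_cubic_algebra scale"
    and "CHAR('k) \<noteq> 2" and "CHAR('k) \<noteq> 3"
    and "\<gamma> dvd 1"
    and "generates_algebra scale \<omega>"
    and "C \<subseteq> {\<delta>. \<delta> \<noteq> 0}" and "C \<noteq> {}"
  shows "card (X_sing scale \<omega> C \<gamma>) =
           (\<Sum>\<delta>\<in>C. card {u::'k. u \<noteq> 0 \<and> u ^ 3 = - (alg_norm scale \<gamma> * \<delta> * elem_disc scale \<omega>)}) \<and>
         card (X_set scale C \<gamma>) = (\<Sum>\<delta>\<in>C. trace_zero_count scale (alg_norm scale \<gamma> * \<delta>)) \<and>
         int (card (X_set scale C \<gamma> - X_sing scale \<omega> C \<gamma>)) =
           int (\<Sum>\<delta>\<in>C. trace_zero_count scale (alg_norm scale \<gamma> * \<delta>)) -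
           int (\<Sum>\<delta>\<in>C. card {u::'k. u \<noteq> 0 \<and> u ^ 3 = - (alg_norm scale \<gamma> * \<delta> * elem_disc scale \<omega>)}) \<and>
         (\<forall>\<delta>. \<delta> \<noteq> 0 \<longrightarrow>
           (CARD('k) mod 3 = 2 \<longrightarrow> card (X_sing scale \<omega> {\<delta>} \<gamma>) = 1) \<and>
           (CARD('k) mod 3 = 1 \<and>
              - (alg_norm scale \<gamma> * \<delta> * elem_disc scale \<omega>) \<in> {u ^ 3 | u. u \<noteq> 0} \<longrightarrow>
              card (X_sing scale \<omega> {\<delta>} \<gamma>) = 3) \<and>
           (CARD('k) mod 3 = 1 \<and>
              - (alg_norm scale \<gamma> * \<delta> * elem_disc scale \<omega>) \<notin> {u ^ 3 | u. u \<noteq> 0} \<longrightarrow>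
              card (X_sing scale \<omega> {\<delta>} \<gamma>) = 0))"
proof -
  have etale: "finite_etale_algebra scale"
    using assms(1) by (simp add: finite_etale_cubic_algebra_def)
  then interpret comm_algebra scale
    by (simp add: finite_etale_algebra_def)
  interpret monogenic_algebra scale \<omega>
    using etale assms(5) by unfold_locales (auto simp: finite_etale_algebra_def)
  have rank: "rank = 3"
    using assms(1) by (simp add: finite_etale_cubic_algebra_def)
  have different: "different dvd 1"
    by (rule different_unit_if_etale[OF etale])
  note sing = card_X_sing_fiber[OF rank assms(4) different]
  have "elem_disc scale \<omega> \<noteq> 0"
    using alg_norm_unit_nonzero[OF different] by (simp add: alg_norm_different rank)
  then have nonzero: "- (alg_norm scale \<gamma> * \<delta> * elem_disc scale \<omega>) \<noteq> 0" if "\<delta> \<noteq> 0" for \<delta>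
    using that alg_norm_unit_nonzero[OF assms(4)] by simp
  show ?thesis
    unfolding card_X_set_diff_X_sing[OF finite] card_X_set_eq_sum_fibers[OF finite, of C]
      card_X_sing_eq_sum_fibers[OF finite, of _ C] card_X_set_fiber[OF assms(4)] sing
    by (intro conjI allI impI refl card_nonzero_cube_roots nonzero) auto
qed

end
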